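(* Let $0<q\le\infty$, $0<\alpha<\infty$, $w,v\in\mathcal{W}(0,\infty)$, and let $T$ be a monotone quasilinear operator on $\mathfrak{M}^+(0,\infty)$. Then the inequality $$\|Tf\|_{q,w,(0,\infty)}\le C\,\|f\|_{1,v,(0,\infty)},\qquad f\in\mathfrak{M}^{+,\downarrow}(0,\infty),$$ holds if and only if the inequality $$\left\|T\left(\frac{1}{V(x)^{\alpha+1}}\int_0^x h\,V^\alpha\right)\right\|_{q,w,(0,\infty)}\le C\,\|h\|_{1,(0,\infty)},\qquad h\in\mathfrak{M}^+(0,\infty),$$ holds, where $$V(x):=\int_0^x v(t)\,dt,\qquad x\in(0,\infty).$$
   Context: $\mathfrak{M}^+(0,\infty)$ is the set of measurable functions on $(0,\infty)$ that are non-negative on $(0,\infty)$; $\mathfrak{M}^{+,\downarrow}(0,\infty)$ is the subset of non-increasing functions in $\mathfrak{M}^+(0,\infty)$; $\mathcal{W}(0,\infty)$ is the set of weights, i.e. measurable functions that are positive almost everywhere on $(0,\infty)$. For $\omega\in\mathfrak{M}^+(0,\infty)$: $\|f\|_{s,\omega,(0,\infty)}=\left(\int_0^\infty |f(x)|^s\omega(x)\,dx\right)^{1/s}$ if $s\in(0,\infty)$, and $\|f\|_{\infty,\omega,(0,\infty)}=\operatorname{ess\,sup}_{x\in(0,\infty)}|f(x)|\,\omega(x)$. When $\omega\equiv1$ one writes $\|f\|_{s,(0,\infty)}$. A monotone quasilinear operator on $\mathfrak{M}^+(0,\infty)$ is a map $T:\mathfrak{M}^+(0,\infty)\to\mathfrak{M}^+(0,\infty)$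 such that: (i) $T(\lambda f)=\lambda Tf$ for all $\lambda\ge0$ and $f\in\mathfrak{M}^+(0,\infty)$; (ii) there is a constant $c>0$, independent of $f,g$, such that $Tf(x)\le c\,Tg(x)$ for almost all $x$ whenever $f(x)\le g(x)$ for almost all $x$; (iii) there is a constant $c>0$, independent of $f,g$, such that $T(f+g)\le c\,(Tf+Tg)$ for all $f,g\in\mathfrak{M}^+(0,\infty)$. In the second inequality $T$ acts on the function $x\mapsto V(x)^{-\alpha-1}\int_0^x h(t)V(t)^\alpha\,dt$. An inequality "holds" if there is a constant $C>0$, independent of the function ($f$ or $h$), for which it is valid for all indicated functions; the constant $C$ may vary from one inequality to another. Conventions: $0\cdot\infty=0$, $\infty/\infty=0$, $0/0=0$. *)

theory Defs
  imports "HOL-Analysis.Analysis" "HOL-Probability.Essential_Supremum"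
begin

text \<open>
  Functions on the half-line take values in \<^typ>\<open>ennreal\<close>, whose multiplication and division
  satisfy \<open>0 * \<infinity> = 0\<close>, \<open>\<infinity> / \<infinity> = 0\<close>, \<open>0 / 0 = 0\<close> and \<open>1 / \<infinity> = 0\<close>.
  A function on \<open>(0, \<infinity>)\<close> is represented by a total function on \<^typ>\<open>real\<close> whose values on
  \<open>(-\<infinity>, 0]\<close> are irrelevant.
\<close>

abbreviation half_line :: "real measure" where
  "half_line \<equiv> lebesgue_on {0<..}"

definition Mplus :: "(real \<Rightarrow> ennreal) set" where
  "Mplus = borel_measurable half_line"

definition Mplus_down :: "(real \<Rightarrow> ennreal) set" where
  "Mplus_down = {f \<in> Mplus. antimono_on {0<..} f}"

text \<open>
  A weight enters only through integrals and essential suprema, so its possible nonpositive values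
  on a null set play no role and it is taken from \<open>Mplus\<close>.
\<close>

definition weights :: "(real \<Rightarrow> ennreal) set" where
  "weights = {w \<in> Mplus. AE x in half_line. 0 < w x}"

text \<open>Real powers on \<open>[0, \<infinity>]\<close>, meant for exponents \<open>a > 0\<close> only: \<open>0\<^sup>a = 0\<close> and \<open>\<infinity>\<^sup>a = \<infinity>\<close>.\<close>

definition epow :: "ennreal \<Rightarrow> real \<Rightarrow> ennreal" (infixr "epow" 80) where
  "x epow a = (if x = \<infinity> then \<infinity> else ennreal (enn2real x powr a))"

text \<open>The functional \<open>\<parallel>f\<parallel>\<^sub>s\<^sub>,\<^sub>\<omega>\<close> on \<open>(0, \<infinity>)\<close>, for \<open>0 < s \<le> \<infinity>\<close>.\<close>

definition wnorm :: "ennreal \<Rightarrow> (real \<Rightarrow> ennreal) \<Rightarrow> (real \<Rightarrow> ennreal) \<Rightarrow> ennreal" where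
  "wnorm s \<omega> f =
     (if s = \<infinity> then esssup half_line (\<lambda>x. f x * \<omega> x)
      else (\<integral>\<^sup>+x. f x epow enn2real s * \<omega> x \<partial>half_line) epow (1 / enn2real s))"

definition int_upto :: "(real \<Rightarrow> ennreal) \<Rightarrow> real \<Rightarrow> ennreal" where
  "int_upto f x = (\<integral>\<^sup>+t\<in>{0<..<x}. f t \<partial>half_line)"

text \<open>
  Equalities and inequalities between elements of \<open>Mplus\<close> are understood almost everywhere
  in all three conditions; this includes operators that satisfy them pointwise.
\<close>

definition monotone_quasilinear :: "((real \<Rightarrow> ennreal) \<Rightarrow> (real \<Rightarrow> ennreal)) \<Rightarrow> bool" where
  "monotone_quasilinear T \<longleftrightarrow>
     T \<in> Mplus \<rightarrow> Mplus \<and>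
     (\<forall>c::real. \<forall>f\<in>Mplus. 0 \<le> c \<longrightarrow>
        (AE x in half_line. T (\<lambda>t. ennreal c * f t) x = ennreal c * T f x)) \<and>
     (\<exists>c::real. 0 < c \<and> (\<forall>f\<in>Mplus. \<forall>g\<in>Mplus.
        (AE x in half_line. f x \<le> g x) \<longrightarrow>
        (AE x in half_line. T f x \<le> ennreal c * T g x))) \<and>
     (\<exists>c::real. 0 < c \<and> (\<forall>f\<in>Mplus. \<forall>g\<in>Mplus.
        AE x in half_line. T (\<lambda>t. f t + g t) x \<le> ennreal c * (T f x + T g x)))"

end

theory Submission
  imports Defs
begin

text \<open>
  Write \<open>A h (x) = V(x)\<^sup>-\<^sup>\<alpha>\<^sup>-\<^sup>1 \<integral>\<^sub>0\<^sup>x h V\<^sup>\<alpha>\<close>. Up to constants, the functions \<open>A h\<close> with \<open>\<integral> h \<le> 1\<close>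
  and the non-increasing functions \<open>f\<close> with \<open>\<integral> f v \<le> 1\<close> dominate each other, and a monotone
  homogeneous \<open>T\<close> passes a domination \<open>f \<le> K g\<close> on to the norms of \<open>T f\<close> and \<open>T g\<close>
  (\<open>monotone_quasilinear_wnorm_le\<close>). So the equivalence is about functions, not about \<open>T\<close>.

  A non-increasing \<open>f\<close> with \<open>\<integral> f v < \<infinity>\<close> satisfies \<open>f \<le> 2\<^sup>\<alpha>\<^sup>+\<^sup>1 A (f v)\<close>
  (\<open>decreasing_le_averaging\<close>): on \<open>(0, x)\<close> it is at least \<open>f(x)\<close>, at least half of the mass \<open>V(x)\<close> lies where \<open>V > V(x)/2\<close>, and there \<open>V\<^sup>\<alpha>\<close>
  is at least \<open>(V(x)/2)\<^sup>\<alpha>\<close>.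

  Conversely \<open>A h\<close> need not be monotone, but its kernel \<open>V(t)\<^sup>\<alpha> / V(x)\<^sup>\<alpha>\<^sup>+\<^sup>1\<close>, restricted to \<open>t < x\<close>, lies
  below \<open>V(t)\<^sup>\<alpha> / max (V(t)) (V(x))\<^sup>\<alpha>\<^sup>+\<^sup>1\<close>, which is non-increasing in \<open>x\<close>. Integrated against
  \<open>v(x) dx\<close>, the larger kernel is bounded uniformly in \<open>t\<close> (\<open>kernel_integral_le\<close>), so by Tonelli's
  theorem it produces a non-increasing majorant \<open>F\<close> of \<open>A h\<close> with \<open>\<integral> F v \<le> K \<integral> h\<close>
  (\<open>averaging_le_decreasing\<close>).

  Both estimates rest on one fact about \<open>V\<close>: the weight \<open>v\<close> gives mass at most \<open>s\<close> to the set where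
  \<open>V \<le> s\<close> (\<open>nn_integral_sublevel_le\<close>). This replaces the substitution \<open>dV = v dx\<close>, and it holds
  also when \<open>V\<close> jumps to \<open>\<infinity>\<close>. Where \<open>V = \<infinity>\<close> the function \<open>A h\<close> vanishes; so does
  every non-increasing \<open>f\<close> with \<open>\<integral> f v < \<infinity>\<close>.
\<close>

section \<open>Powers in the extended half-line\<close>

lemma divide_left_mono_ennreal:
  fixes a b c :: ennreal
  assumes "b \<le> a" shows "c / a \<le> c / b"
proof -
  have "inverse a \<le> inverse b"
    using assms by (simp add: less_eq_ennreal.rep_eq inverse_ennreal.rep_eq ereal_inverse_antimono)
  then show ?thesis by (simp add: divide_ennreal_def mult_left_mono)
qed

lemma epow_mono: "0 \<le> a \<Longrightarrow> x \<le> y \<Longrightarrow> x epow a \<le> y epow a"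
  by (cases x; cases y) (auto simp: epow_def ennreal_le_iff2 top_unique intro!: ennreal_leI powr_mono2)

lemma epow_ennreal: "0 \<le> r \<Longrightarrow> ennreal r epow a = ennreal (r powr a)"
  by (simp add: epow_def)

lemma epow_cmult:
  assumes "0 < c" shows "(ennreal c * x) epow a = ennreal (c powr a) * x epow a"
proof (cases "x = \<infinity>")
  case True
  with assms show ?thesis by (simp add: epow_def ennreal_mult_top)
next
  case False
  then obtain r where "x = ennreal r" "0 \<le> r" by (cases x) auto
  with assms show ?thesis
    by (simp add: epow_ennreal ennreal_mult[symmetric] powr_mult)
qed

lemma epow_1: "x epow 1 = x"
  by (cases x) (auto simp: epow_def)

lemma borel_measurable_epow [measurable (raw)]:
  assumes "f \<in> borel_measurable M" shows "(\<lambda>x. f x epow a) \<in> borel_measurable M"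
proof -
  have "(\<lambda>x. x epow a) \<in> borel_measurable borel"
    unfolding epow_def by measurable
  from measurable_compose[OF assms this] show ?thesis .
qed

section \<open>Transfer of domination through the operator\<close>

lemma wnorm_1: "wnorm 1 u f = (\<integral>\<^sup>+x. f x * u x \<partial>half_line)"
  by (simp add: wnorm_def epow_1)

lemma wnorm_le_cmult:
  assumes "0 < q" "0 < c" and "F \<in> Mplus" "G \<in> Mplus" "w \<in> Mplus"
    and le: "AE x in half_line. F x \<le> ennreal c * G x"
  shows "wnorm q w F \<le> ennreal c * wnorm q w G"
proof -
  have [measurable]: "F \<in> borel_measurable half_line" "G \<in> borel_measurable half_line"
      "w \<in> borel_measurable half_line"
    using assms by (auto simp: Mplus_def)
  show ?thesis
  proof (cases "q = \<infinity>")
    case True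
    have "esssup half_line (\<lambda>x. F x * w x) \<le> ennreal c * esssup half_line (\<lambda>x. G x * w x)"
    proof (rule esssup_I)
      show "AE x in half_line. F x * w x \<le> ennreal c * esssup half_line (\<lambda>x. G x * w x)"
        using le esssup_AE[where M = half_line and f = "\<lambda>x. G x * w x"]
      proof eventually_elim
        case (elim x)
        have "F x * w x \<le> (ennreal c * G x) * w x" by (intro mult_right_mono elim) simp
        also have "\<dots> = ennreal c * (G x * w x)" by (simp add: mult.assoc)
        also have "\<dots> \<le> ennreal c * esssup half_line (\<lambda>x. G x * w x)"
          by (intro mult_left_mono elim) simp
        finally show ?case .
      qed
    qed measurable
    with True show ?thesis by (simp add: wnorm_def)
  next
    case False
    define r where "r = enn2real q"
    have r: "0 < r" using False \<open>0 < q\<close> by (simp add: r_def enn2real_positive_iff less_top)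
    have "(\<integral>\<^sup>+x. F x epow r * w x \<partial>half_line)
        \<le> (\<integral>\<^sup>+x. ennreal (c powr r) * (G x epow r * w x) \<partial>half_line)"
      using le
    proof (intro nn_integral_mono_AE, eventually_elim)
      case (elim x)
      have "F x epow r * w x \<le> (ennreal c * G x) epow r * w x"
        using r elim by (intro mult_right_mono epow_mono) auto
      then show ?case using \<open>0 < c\<close> by (simp add: epow_cmult mult.assoc)
    qed
    also have "\<dots> = ennreal (c powr r) * (\<integral>\<^sup>+x. G x epow r * w x \<partial>half_line)"
      by (intro nn_integral_cmult) measurable
    finally have "(\<integral>\<^sup>+x. F x epow r * w x \<partial>half_line) epow (1 / r)
        \<le> (ennreal (c powr r) * (\<integral>\<^sup>+x. G x epow r * w x \<partial>half_line)) epow (1 / r)"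
      using r by (intro epow_mono) auto
    also have "\<dots> = ennreal c * (\<integral>\<^sup>+x. G x epow r * w x \<partial>half_line) epow (1 / r)"
      using r \<open>0 < c\<close> by (simp add: epow_cmult powr_powr)
    finally show ?thesis using False by (simp add: wnorm_def r_def)
  qed
qed

text \<open>
  The constant \<open>D\<close> must not depend on the two functions, since it becomes a factor of the
  constant in the resulting inequality.
\<close>

lemma monotone_quasilinear_wnorm_le:
  assumes T: "monotone_quasilinear T" and "0 < q" "w \<in> Mplus" "0 < K"
  obtains D :: real where "0 < D"
    and "\<And>f g. f \<in> Mplus \<Longrightarrow> g \<in> Mplus \<Longrightarrow> AE x in half_line. f x \<le> ennreal K * g x
      \<Longrightarrow> wnorm q w (T f) \<le> ennreal D * wnorm q w (T g)"
proof -
  from T obtain c :: real where c: "0 < c" and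
    mono: "\<And>f g. f \<in> Mplus \<Longrightarrow> g \<in> Mplus \<Longrightarrow> AE x in half_line. f x \<le> g x
      \<Longrightarrow> AE x in half_line. T f x \<le> ennreal c * T g x"
    unfolding monotone_quasilinear_def by blast
  show thesis
  proof (rule that[of "c * K"])
    fix f g assume fg: "f \<in> Mplus" "g \<in> Mplus" "AE x in half_line. f x \<le> ennreal K * g x"
    have Kg: "(\<lambda>x. ennreal K * g x) \<in> Mplus" using fg(2) by (simp add: Mplus_def)
    have "AE x in half_line. T (\<lambda>t. ennreal K * g t) x = ennreal K * T g x"
      using T fg \<open>0 < K\<close> by (simp add: monotone_quasilinear_def)
    with mono[OF fg(1) Kg fg(3)]
    have "AE x in half_line. T f x \<le> ennreal (c * K) * T g x"
      by eventually_elim (use c \<open>0 < K\<close> in \<open>simp add: ennreal_mult mult.assoc\<close>)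
    moreover have "T f \<in> Mplus" "T g \<in> Mplus"
      using T fg by (auto simp: monotone_quasilinear_def)
    ultimately show "wnorm q w (T f) \<le> ennreal (c * K) * wnorm q w (T g)"
      using c assms by (intro wnorm_le_cmult) auto
  qed (use c \<open>0 < K\<close> in simp)
qed

section \<open>The primitive of a weight\<close>

lemma sigma_finite_half_line: "sigma_finite_measure half_line"
proof (rule sigma_finite_measure_restrict_space)
  show "sigma_finite_measure (lebesgue :: real measure)"
  proof
    show "\<exists>A. countable A \<and> A \<subseteq> sets (lebesgue :: real measure) \<and> \<Union>A = space lebesgue
        \<and> (\<forall>a\<in>A. emeasure lebesgue a \<noteq> \<infinity>)"
    proof (intro exI[of _ "range (\<lambda>n::nat. {- real n..real n})"] conjI)
      show "\<Union> (range (\<lambda>n::nat. {- real n..real n})) = space lebesgue"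
      proof -
        have "\<exists>n::nat. - real n \<le> x \<and> x \<le> real n" for x :: real
          using real_arch_simple[of "\<bar>x\<bar>"] by (metis abs_le_iff minus_le_iff)
        then show ?thesis by auto
      qed
    qed auto
  qed
qed simp

interpretation half_line: sigma_finite_measure half_line
  by (rule sigma_finite_half_line)

interpretation half_line_pair: pair_sigma_finite half_line half_line ..

lemma int_upto_mono: "x \<le> y \<Longrightarrow> int_upto u x \<le> int_upto u y"
  unfolding int_upto_def by (intro nn_integral_mono) (auto split: split_indicator)

lemma borel_measurable_int_upto [measurable]:
  assumes "u \<in> Mplus" shows "int_upto u \<in> borel_measurable half_line"
proof -
  have [measurable]: "u \<in> borel_measurable half_line" using assms by (simp add: Mplus_def)
  have id: "(\<lambda>x. x) \<in> borel_measurable half_line"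
    by (intro measurable_restrict_space1 measurable_completion) simp
  have "(\<lambda>x. \<integral>\<^sup>+t. u t * indicator {p. 0 < snd p \<and> snd p < fst p} (x, t) \<partial>half_line)
      \<in> borel_measurable half_line"
  proof -
    have "{p. 0 < snd p \<and> snd p < (fst p :: real)} \<in> sets (borel \<Otimes>\<^sub>M borel)"
      unfolding borel_prod
      by (intro borel_open open_Collect_conj open_Collect_less continuous_intros)
    moreover have "(\<lambda>p. (fst p, snd p)) \<in> half_line \<Otimes>\<^sub>M half_line \<rightarrow>\<^sub>M borel \<Otimes>\<^sub>M borel"
      by (intro measurable_Pair measurable_compose[OF measurable_fst id]
          measurable_compose[OF measurable_snd id])
    then have "(\<lambda>p. p) \<in> half_line \<Otimes>\<^sub>M half_line \<rightarrow>\<^sub>M borel \<Otimes>\<^sub>M borel" by simp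
    ultimately have [measurable]: "(\<lambda>p. indicator {p. 0 < snd p \<and> snd p < (fst p :: real)} p :: ennreal)
      \<in> borel_measurable (half_line \<Otimes>\<^sub>M half_line)"
      by measurable
    show ?thesis by measurable
  qed
  then show ?thesis
    unfolding int_upto_def[abs_def] by (simp add: indicator_def greaterThanLessThan_def)
qed

lemma AE_half_line_neq: "AE x in half_line. x \<noteq> b"
proof -
  have "AE x in lebesgue. x \<noteq> b"
    using AE_completion[OF AE_lborel_singleton] .
  then show ?thesis by (subst AE_restrict_space_iff) auto
qed

text \<open>
  The sublevel set is an initial interval. Up to its right end point, a null set, it is exhausted
  by the intervals \<open>(0, X n)\<close> with \<open>X n\<close> inside the set, and their masses are \<open>V (X n) \<le> s\<close>.
\<close>

lemma nn_integral_sublevel_le: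
  assumes u: "u \<in> Mplus"
  shows "(\<integral>\<^sup>+t. u t * indicator {t. int_upto u t \<le> s} t \<partial>half_line) \<le> s"
proof -
  have [measurable]: "u \<in> borel_measurable half_line" using assms by (simp add: Mplus_def)
  have [measurable]: "{0<..<X} \<in> sets half_line" for X :: real
    by (auto simp: sets_restrict_space_iff)
  \<comment> \<open>As a subset of the whole real line \<open>L\<close> contains 0, where the primitive vanishes.\<close>
  define L where "L = {t. int_upto u t \<le> s}"
  have down: "x \<in> L" if "y \<in> L" "x \<le> y" for x y
    using that int_upto_mono[of x y u] by (auto simp: L_def)
  have "0 \<in> L" by (simp add: L_def int_upto_def)
  obtain X :: "nat \<Rightarrow> real" where X: "incseq X" "\<And>n. X n \<in> L"
    and ev: "AE t in half_line. t \<in> L \<longrightarrow> (\<exists>n. t < X n)"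
  proof (cases "bdd_above L")
    case True
    show thesis
    proof (rule that[of "\<lambda>n. Sup L - 1 / Suc n"])
      show "incseq (\<lambda>n. Sup L - 1 / Suc n)"
        by (auto intro!: incseq_SucI simp: frac_le)
      fix n
      have "Sup L - 1 / Suc n < Sup L" by simp
      then obtain l where "l \<in> L" "Sup L - 1 / Suc n < l"
        using \<open>0 \<in> L\<close> True less_cSup_iff[of L] by blast
      then show "Sup L - 1 / Suc n \<in> L" using down[of l] by auto
    next
      show "AE t in half_line. t \<in> L \<longrightarrow> (\<exists>n. t < Sup L - 1 / Suc n)"
        using AE_half_line_neq[of "Sup L"]
      proof eventually_elim
        case (elim t)
        show ?case
        proof
          assume "t \<in> L"
          with elim True have "0 < Sup L - t" using cSup_upper[of t L] by fastforce
          from reals_Archimedean[OF this] obtain n where "inverse (Suc n) < Sup L - t" by blast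
          then have "t < Sup L - 1 / Suc n" by (simp add: inverse_eq_divide)
          then show "\<exists>n. t < Sup L - 1 / Suc n" by blast
        qed
      qed
    qed
  next
    case False
    show thesis
    proof (rule that[of real])
      show "real n \<in> L" for n
        using False down by (metis bdd_aboveI linear)
      show "AE t in half_line. t \<in> L \<longrightarrow> (\<exists>n. t < real n)"
        by (simp add: reals_Archimedean2)
    qed (auto simp: incseq_def)
  qed
  have "(\<integral>\<^sup>+t. u t * indicator L t \<partial>half_line)
      \<le> (\<integral>\<^sup>+t. (SUP n. u t * indicator {0<..<X n} t) \<partial>half_line)"
  proof (rule nn_integral_mono_AE)
    have "AE t in half_line. 0 < t" by (rule AE_I2) simp
    with ev show "AE t in half_line. u t * indicator L t \<le> (SUP n. u t * indicator {0<..<X n} t)"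
    proof eventually_elim
      case (elim t)
      show ?case
      proof (cases "t \<in> L")
        case True
        with elim obtain n where "t < X n" by blast
        then show ?thesis using True elim by (intro SUP_upper2[of n]) auto
      qed simp
    qed
  qed
  also have "\<dots> = (SUP n. int_upto u (X n))"
    unfolding int_upto_def
  proof (rule nn_integral_monotone_convergence_SUP)
    show "incseq (\<lambda>n t. u t * indicator {0<..<X n} t)"
      using X(1) by (auto simp: incseq_def le_fun_def split: split_indicator) (meson less_le_trans)+
  qed measurable
  also have "\<dots> \<le> s" using X(2) by (intro SUP_least) (simp add: L_def)
  finally show ?thesis by (simp add: L_def)
qed

lemma int_upto_weight_pos:
  assumes v: "v \<in> weights" and "0 < x"
  shows "0 < int_upto v x"
proof (rule ccontr)
  assume "\<not> 0 < int_upto v x"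
  then have "(\<integral>\<^sup>+t. v t * indicator {0<..<x} t \<partial>half_line) = 0"
    by (simp add: int_upto_def)
  moreover have [measurable]: "v \<in> borel_measurable half_line" "{0<..<x} \<in> sets half_line"
    using v by (auto simp: weights_def Mplus_def sets_restrict_space_iff)
  ultimately have "AE t in half_line. v t * indicator {0<..<x} t = 0"
    by (subst (asm) nn_integral_0_iff_AE) measurable
  moreover have "AE t in half_line. 0 < v t" using v by (simp add: weights_def)
  ultimately have "AE t in half_line. t \<notin> {0<..<x}"
    by eventually_elim auto
  then have "AE t in lebesgue. t \<notin> {0<..<x}"
    by (subst (asm) AE_restrict_space_iff) auto
  then have "emeasure lebesgue {0<..<x} = 0"
    by (subst (asm) AE_iff_measurable[of "{0<..<x}"]) auto
  then show False using \<open>0 < x\<close> by simp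
qed

section \<open>A non-increasing function is dominated by an average\<close>

text \<open>
  If \<open>V(x)\<close> is finite, the sublevel estimate at height \<open>H = V(x)/2\<close> leaves mass at least \<open>H\<close> for
  \<open>S = {t < x. V(t) > H}\<close>, and the integral over \<open>S\<close> alone is at least \<open>f(x) H\<^sup>\<alpha> H\<close>. If \<open>V(x) = \<infinity>\<close>
  the right-hand side is 0, and \<open>f(x) V(x) \<le> \<integral> f v < \<infinity>\<close> forces \<open>f(x) = 0\<close>.
\<close>

lemma decreasing_le_averaging:
  assumes v: "v \<in> weights" and "0 < \<alpha>" and f: "f \<in> Mplus_down"
    and fin: "(\<integral>\<^sup>+t. f t * v t \<partial>half_line) < \<infinity>" and "0 < x"
  shows "f x \<le> ennreal (2 powr (\<alpha> + 1)) *
    (1 / (int_upto v x epow (\<alpha> + 1)) * int_upto (\<lambda>t. f t * v t * int_upto v t epow \<alpha>) x)"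
proof -
  define V where "V = int_upto v"
  have vM: "v \<in> Mplus" using v by (simp add: weights_def)
  have [measurable]: "v \<in> borel_measurable half_line" "f \<in> borel_measurable half_line"
      "V \<in> borel_measurable half_line" "{0<..<x} \<in> sets half_line"
    using vM f by (auto simp: V_def Mplus_down_def Mplus_def sets_restrict_space_iff)
  have dec: "f x \<le> f t" if "0 < t" "t < x" for t
    using f that by (auto simp: Mplus_down_def monotone_on_def)
  have "f x * V x = (\<integral>\<^sup>+t. f x * (v t * indicator {0<..<x} t) \<partial>half_line)"
    unfolding V_def int_upto_def by (intro nn_integral_cmult[symmetric]) measurable
  also have "\<dots> \<le> (\<integral>\<^sup>+t. f t * v t \<partial>half_line)"
    using dec by (intro nn_integral_mono) (auto split: split_indicator intro!: mult_right_mono)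
  finally have fV: "f x * V x < \<infinity>" using fin by simp
  show ?thesis
  proof (cases "V x = \<infinity>")
    case True
    with fV have "f x = 0" by (auto simp: ennreal_mult_top split: if_splits)
    then show ?thesis by simp
  next
    case False
    then obtain r where r: "V x = ennreal r" "0 < r"
      using int_upto_weight_pos[OF v \<open>0 < x\<close>] by (cases "V x") (auto simp: V_def)
    define H where "H = ennreal (r / 2)"
    define S where "S = {t\<in>{0<..<x}. H < V t}"
    have S [measurable]: "S \<in> sets half_line"
    proof -
      have "S = {0<..<x} \<inter> {t \<in> space half_line. H < V t}" by (auto simp: S_def)
      also have "\<dots> \<in> sets half_line" by measurable
      finally show ?thesis .
    qed
    have "V x \<le> (\<integral>\<^sup>+t. v t * indicator S t + v t * indicator {t. V t \<le> H} t \<partial>half_line)"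
      unfolding V_def int_upto_def
      by (intro nn_integral_mono) (auto simp: S_def V_def int_upto_def split: split_indicator)
    also have "\<dots> = (\<integral>\<^sup>+t. v t * indicator S t \<partial>half_line)
        + (\<integral>\<^sup>+t. v t * indicator {t. V t \<le> H} t \<partial>half_line)"
    proof (rule nn_integral_add)
      show "(\<lambda>t. v t * indicator {t. V t \<le> H} t) \<in> borel_measurable half_line"
        by (simp add: indicator_def)
    qed measurable
    also have "\<dots> \<le> (\<integral>\<^sup>+t. v t * indicator S t \<partial>half_line) + H"
      using nn_integral_sublevel_le[OF vM, of H] by (intro add_left_mono) (simp add: V_def)
    finally have half: "H \<le> (\<integral>\<^sup>+t. v t * indicator S t \<partial>half_line)"
    proof -
      assume "V x \<le> (\<integral>\<^sup>+t. v t * indicator S t \<partial>half_line) + H"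
      moreover have "V x = H + H" using r by (simp add: H_def ennreal_plus[symmetric] del: ennreal_plus)
      ultimately have "H + H \<le> H + (\<integral>\<^sup>+t. v t * indicator S t \<partial>half_line)"
        by (simp add: add.commute)
      then show ?thesis by (simp add: ennreal_add_left_cancel_le H_def)
    qed
    have "f x * H epow \<alpha> * H \<le> f x * H epow \<alpha> * (\<integral>\<^sup>+t. v t * indicator S t \<partial>half_line)"
      using half by (intro mult_left_mono) auto
    also have "\<dots> = (\<integral>\<^sup>+t. f x * H epow \<alpha> * (v t * indicator S t) \<partial>half_line)"
      by (intro nn_integral_cmult[symmetric]) measurable
    also have "\<dots> \<le> int_upto (\<lambda>t. f t * v t * V t epow \<alpha>) x"
      unfolding int_upto_def
    proof (intro nn_integral_mono)
      fix t
      show "f x * H epow \<alpha> * (v t * indicator S t)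
          \<le> f t * v t * V t epow \<alpha> * indicator {0<..<x} t"
      proof (cases "t \<in> S")
        case True
        then have "f x * H epow \<alpha> * v t \<le> f t * V t epow \<alpha> * v t"
          using \<open>0 < \<alpha>\<close> dec by (intro mult_right_mono mult_mono epow_mono) (auto simp: S_def)
        then show ?thesis using True by (simp add: S_def mult_ac)
      qed simp
    qed
    finally have main: "f x * H epow \<alpha> * H \<le> int_upto (\<lambda>t. f t * v t * V t epow \<alpha>) x" .
    \<comment> \<open>The constant is chosen to give \<open>2\<^sup>\<alpha>\<^sup>+\<^sup>1 H\<^sup>\<alpha> H = V(x)\<^sup>\<alpha>\<^sup>+\<^sup>1\<close>.\<close>
    have eq: "ennreal (2 powr (\<alpha> + 1)) * (1 / (V x epow (\<alpha> + 1))) * (H epow \<alpha> * H) = 1"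
    proof -
      have "ennreal (2 powr (\<alpha> + 1)) * (1 / (V x epow (\<alpha> + 1))) * (H epow \<alpha> * H)
        = ennreal (2 powr (\<alpha> + 1) * (1 / r powr (\<alpha> + 1)) * ((r/2) powr \<alpha> * (r/2)))"
      proof -
        have "1 / (V x epow (\<alpha> + 1)) = ennreal (1 / r powr (\<alpha> + 1))"
          using r by (simp add: epow_ennreal divide_ennreal[symmetric])
        moreover have "H epow \<alpha> = ennreal ((r/2) powr \<alpha>)"
          using r unfolding H_def by (intro epow_ennreal) simp
        moreover have "ennreal a * ennreal b * (ennreal c * ennreal d) = ennreal (a * b * (c * d))"
          if "0 \<le> a" "0 \<le> b" "0 \<le> c" "0 \<le> d" for a b c d
          using that by (simp add: ennreal_mult)
        ultimately show ?thesis using r by (simp add: H_def del: ennreal_divide_numeral)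
      qed
      also have "2 powr (\<alpha> + 1) * (1 / r powr (\<alpha> + 1)) * ((r/2) powr \<alpha> * (r/2)) = 1"
        using r by (simp add: powr_add powr_divide field_simps)
      finally show ?thesis by simp
    qed
    have "f x = ennreal (2 powr (\<alpha> + 1)) * (1 / (V x epow (\<alpha> + 1))) * (f x * H epow \<alpha> * H)"
      using eq by (metis mult.assoc mult.left_commute mult.right_neutral)
    also have "\<dots> \<le> ennreal (2 powr (\<alpha> + 1)) * (1 / (V x epow (\<alpha> + 1))) *
        int_upto (\<lambda>t. f t * v t * V t epow \<alpha>) x"
      by (intro mult_left_mono main) simp
    finally show ?thesis by (simp add: V_def mult.assoc)
  qed
qed

section \<open>An average is dominated by a non-increasing function\<close>

text \<open>
  For finite \<open>y\<close> the number \<open>max r y\<close> lies in some \<open>[2\<^sup>n r, 2\<^sup>n\<^sup>+\<^sup>1 r]\<close>, and the term of that index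
  suffices. Adding all terms turns a negative power of the primitive into indicators of its
  sublevel sets, whose masses are known.
\<close>

lemma inverse_epow_max_le_dyadic_sum:
  fixes y :: ennreal
  assumes "0 < r" "0 < a"
  shows "1 / (max (ennreal r) y epow a)
    \<le> (\<Sum>n. ennreal ((2 ^ n * r) powr - a) * indicator {..ennreal (2 ^ Suc n * r)} y)"
proof (cases y)
  case top
  then show ?thesis by (simp add: epow_def)
next
  case (real s)
  define m where "m = max r s"
  have "\<exists>n. m \<le> 2 ^ Suc n * r"
  proof -
    obtain n where "m / r < 2 ^ n" using real_arch_pow[of 2 "m / r"] by auto
    also have "(2::real) ^ n \<le> 2 ^ Suc n" by simp
    finally show ?thesis using \<open>0 < r\<close> by (intro exI[of _ n]) (simp add: field_simps)
  qed
  define n where "n = (LEAST n. m \<le> 2 ^ Suc n * r)"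
  have n: "m \<le> 2 ^ Suc n * r"
    unfolding n_def by (rule LeastI_ex) fact
  have n': "2 ^ n * r \<le> m"
  proof (cases n)
    case 0
    then show ?thesis by (simp add: m_def)
  next
    case (Suc k)
    then have "\<not> m \<le> 2 ^ Suc k * r"
      using not_less_Least[of k "\<lambda>n. m \<le> 2 ^ Suc n * r"] by (simp add: n_def)
    then show ?thesis using Suc by simp
  qed
  have "max (ennreal r) y = ennreal m"
    using real \<open>0 < r\<close> by (auto simp: m_def max_def ennreal_le_iff2)
  moreover have "0 < m" using \<open>0 < r\<close> by (simp add: m_def)
  ultimately have "1 / (max (ennreal r) y epow a) = ennreal (1 / m powr a)"
    by (simp add: epow_ennreal divide_ennreal[symmetric])
  also have "1 / m powr a = m powr - a" by (simp add: powr_minus_divide)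
  also have "ennreal (m powr - a) \<le> ennreal ((2 ^ n * r) powr - a)"
    using n' assms by (intro ennreal_leI powr_mono2') auto
  also have "\<dots> = ennreal ((2 ^ n * r) powr - a) * indicator {..ennreal (2 ^ Suc n * r)} y"
  proof -
    have "y \<le> ennreal (2 ^ Suc n * r)"
      unfolding real(2) using n by (intro ennreal_leI) (simp add: m_def)
    then show ?thesis by (simp del: power_Suc)
  qed
  also have "\<dots> \<le> (\<Sum>n. ennreal ((2 ^ n * r) powr - a) * indicator {..ennreal (2 ^ Suc n * r)} y)"
    using sum_le_suminf[OF summableI, of "{n}"] by simp
  finally show ?thesis .
qed

text \<open>
  For \<open>b = r\<close> finite and positive, the \<open>n\<close>-th dyadic term contributes at most
  \<open>(2\<^sup>n r)\<^sup>-\<^sup>\<alpha>\<^sup>-\<^sup>1 2\<^sup>n\<^sup>+\<^sup>1 r = 2 r\<^sup>-\<^sup>\<alpha> 2\<^sup>-\<^sup>n\<^sup>\<alpha>\<close>, a geometric series whose factor \<open>r\<^sup>-\<^sup>\<alpha>\<close> cancels against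
  \<open>b\<^sup>\<alpha>\<close>. The bound is therefore independent of \<open>b\<close>.
\<close>

lemma kernel_integral_le:
  assumes u: "u \<in> Mplus" and "0 < \<alpha>"
  shows "b epow \<alpha> * (\<integral>\<^sup>+x. 1 / (max b (int_upto u x) epow (\<alpha> + 1)) * u x \<partial>half_line)
    \<le> ennreal (2 / (1 - 2 powr - \<alpha>))"
proof (cases b)
  case top
  then have "max b y = \<infinity>" for y by (simp add: max_absorb1)
  then show ?thesis by (simp add: epow_def)
next
  case (real r)
  define V where "V = int_upto u"
  have [measurable]: "u \<in> borel_measurable half_line" "V \<in> borel_measurable half_line"
    using u by (auto simp: V_def Mplus_def)
  show ?thesis
  proof (cases "r = 0")
    case True
    then show ?thesis using real by (simp add: epow_def)
  next
    case False
    with real have r: "0 < r" by simp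
    let ?c = "\<lambda>n. (2 ^ n * r) powr - (\<alpha> + 1)"
    have "(\<integral>\<^sup>+x. 1 / (max b (V x) epow (\<alpha> + 1)) * u x \<partial>half_line)
      \<le> (\<integral>\<^sup>+x. (\<Sum>n. ennreal (?c n) * (u x * indicator {t. V t \<le> ennreal (2 ^ Suc n * r)} x)) \<partial>half_line)"
    proof (intro nn_integral_mono)
      fix x
      have "1 / (max b (V x) epow (\<alpha> + 1)) * u x
        \<le> (\<Sum>n. ennreal (?c n) * indicator {..ennreal (2 ^ Suc n * r)} (V x)) * u x"
        using inverse_epow_max_le_dyadic_sum[OF r, of "\<alpha> + 1" "V x"] \<open>0 < \<alpha>\<close> real(2) by (intro mult_right_mono) auto
      also have "\<dots> = (\<Sum>n. ennreal (?c n) * (u x * indicator {t. V t \<le> ennreal (2 ^ Suc n * r)} x))"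
        unfolding ennreal_suminf_multc[symmetric]
        by (intro suminf_cong) (auto split: split_indicator)
      finally show "1 / (max b (V x) epow (\<alpha> + 1)) * u x \<le> \<dots>" .
    qed
    also have "\<dots> = (\<Sum>n. \<integral>\<^sup>+x. ennreal (?c n) * (u x * indicator {t. V t \<le> ennreal (2 ^ Suc n * r)} x) \<partial>half_line)"
      by (intro nn_integral_suminf) (simp add: indicator_def)
    also have "\<dots> \<le> (\<Sum>n. ennreal (?c n) * ennreal (2 ^ Suc n * r))"
    proof (intro suminf_le summableI)
      fix n
      have "(\<integral>\<^sup>+x. ennreal (?c n) * (u x * indicator {t. V t \<le> ennreal (2 ^ Suc n * r)} x) \<partial>half_line)
        = ennreal (?c n) * (\<integral>\<^sup>+x. u x * indicator {t. V t \<le> ennreal (2 ^ Suc n * r)} x \<partial>half_line)"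
        by (intro nn_integral_cmult) (simp add: indicator_def)
      also have "\<dots> \<le> ennreal (?c n) * ennreal (2 ^ Suc n * r)"
        using nn_integral_sublevel_le[OF u] by (intro mult_left_mono) (auto simp: V_def)
      finally show "(\<integral>\<^sup>+x. ennreal (?c n) * (u x * indicator {t. V t \<le> ennreal (2 ^ Suc n * r)} x) \<partial>half_line)
        \<le> \<dots>" .
    qed
    also have "\<dots> = (\<Sum>n. ennreal (2 * r powr - \<alpha> * (2 powr - \<alpha>) ^ n))"
    proof (intro suminf_cong)
      fix n
      have "?c n * (2 ^ Suc n * r) = 2 * ((2 ^ n * r) powr - (\<alpha> + 1) * (2 ^ n * r))" by simp
      also have "(2 ^ n * r) powr - (\<alpha> + 1) * (2 ^ n * r) = (2 ^ n * r) powr - \<alpha>"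
        using r by (simp add: powr_diff)
      also have "\<dots> = r powr - \<alpha> * (2 powr - \<alpha>) ^ n"
        using r by (simp add: powr_mult powr_realpow[symmetric] powr_powr mult.commute)
      finally show "ennreal (?c n) * ennreal (2 ^ Suc n * r) = ennreal (2 * r powr - \<alpha> * (2 powr - \<alpha>) ^ n)"
        using r by (simp add: ennreal_mult[symmetric])
    qed
    also have "\<dots> = ennreal (2 * r powr - \<alpha> * (1 / (1 - 2 powr - \<alpha>)))"
    proof (intro suminf_ennreal_eq)
      have "(2::real) powr - \<alpha> < 2 powr 0" using \<open>0 < \<alpha>\<close> by (intro powr_less_mono) auto
      then show "(\<lambda>n. 2 * r powr - \<alpha> * (2 powr - \<alpha>) ^ n) sums (2 * r powr - \<alpha> * (1 / (1 - 2 powr - \<alpha>)))"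
        by (intro sums_mult geometric_sums) simp
    qed simp
    finally have "b epow \<alpha> * (\<integral>\<^sup>+x. 1 / (max b (V x) epow (\<alpha> + 1)) * u x \<partial>half_line)
        \<le> b epow \<alpha> * ennreal (2 * r powr - \<alpha> * (1 / (1 - 2 powr - \<alpha>)))"
      by (intro mult_left_mono) auto
    also have "\<dots> = ennreal (r powr \<alpha> * (2 * r powr - \<alpha> * (1 / (1 - 2 powr - \<alpha>))))"
      using real by (simp add: epow_ennreal ennreal_mult'[symmetric])
    also have "r powr \<alpha> * (2 * r powr - \<alpha> * (1 / (1 - 2 powr - \<alpha>))) = 2 / (1 - 2 powr - \<alpha>)"
      using r by (simp add: powr_minus)
    finally show ?thesis by (simp add: V_def)
  qed
qed

text \<open>
  The majorant is \<open>F(x) = \<integral> h(t) V(t)\<^sup>\<alpha> / max (V(t)) (V(x))\<^sup>\<alpha>\<^sup>+\<^sup>1 dt\<close>. For \<open>t < x\<close> the maximum is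
  \<open>V(x)\<close>, so this part of the integral is the average itself; the part \<open>t \<ge> x\<close> is
  \<open>\<integral> h / V\<close> over the points where \<open>V\<close> is positive and finite, and it makes \<open>F\<close> monotone.
\<close>

lemma averaging_le_decreasing:
  assumes u: "u \<in> Mplus" and h: "h \<in> Mplus" and "0 < \<alpha>"
  obtains F where "F \<in> Mplus_down"
    and "\<And>x. 1 / (int_upto u x epow (\<alpha> + 1)) * int_upto (\<lambda>t. h t * int_upto u t epow \<alpha>) x \<le> F x"
    and "(\<integral>\<^sup>+x. F x * u x \<partial>half_line)
      \<le> ennreal (2 / (1 - 2 powr - \<alpha>)) * (\<integral>\<^sup>+t. h t \<partial>half_line)"
proof -
  define V where "V = int_upto u"
  have [measurable]: "u \<in> borel_measurable half_line" "V \<in> borel_measurable half_line"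
      "h \<in> borel_measurable half_line"
    using u h by (auto simp: V_def Mplus_def)
  define k where "k t x = h t * V t epow \<alpha> * (1 / (max (V t) (V x) epow (\<alpha> + 1)))" for t x
  have k_meas [measurable]: "(\<lambda>(t, x). k t x) \<in> borel_measurable (half_line \<Otimes>\<^sub>M half_line)"
    unfolding k_def by measurable
  define F where "F x = (\<integral>\<^sup>+t. k t x \<partial>half_line)" for x
  have inv_mono: "1 / (a epow (\<alpha> + 1)) \<le> 1 / (b epow (\<alpha> + 1))" if "b \<le> a" for a b
    using that \<open>0 < \<alpha>\<close> by (intro divide_left_mono_ennreal epow_mono) auto
  show thesis
  proof (rule that[of F])
    have "F \<in> borel_measurable half_line"
      unfolding F_def by measurable
    moreover have "F y \<le> F x" if "x \<le> y" for x y
      unfolding F_def k_def using int_upto_mono[OF that, of u]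
      by (intro nn_integral_mono mult_left_mono inv_mono) (auto simp: V_def max.coboundedI2)
    ultimately show "F \<in> Mplus_down"
      by (auto simp: Mplus_down_def Mplus_def monotone_on_def)
  next
    fix x
    have "1 / (V x epow (\<alpha> + 1)) * int_upto (\<lambda>t. h t * V t epow \<alpha>) x
      = (\<integral>\<^sup>+t. 1 / (V x epow (\<alpha> + 1)) * (h t * V t epow \<alpha> * indicator {0<..<x} t) \<partial>half_line)"
    proof -
      have [measurable]: "{0<..<x} \<in> sets half_line" by (auto simp: sets_restrict_space_iff)
      show ?thesis
        unfolding int_upto_def by (intro nn_integral_cmult[symmetric]) measurable
    qed
    also have "\<dots> \<le> F x"
      unfolding F_def
    proof (intro nn_integral_mono)
      fix t
      show "1 / (V x epow (\<alpha> + 1)) * (h t * V t epow \<alpha> * indicator {0<..<x} t) \<le> k t x"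
      proof (cases "t \<in> {0<..<x}")
        case True
        then have "max (V t) (V x) = V x"
          using int_upto_mono[of t x u] by (simp add: V_def)
        then show ?thesis using True by (simp add: k_def mult.commute)
      qed simp
    qed
    finally show "1 / (int_upto u x epow (\<alpha> + 1)) * int_upto (\<lambda>t. h t * int_upto u t epow \<alpha>) x \<le> F x"
      by (simp add: V_def)
  next
    have "(\<integral>\<^sup>+x. F x * u x \<partial>half_line) = (\<integral>\<^sup>+x. (\<integral>\<^sup>+t. k t x * u x \<partial>half_line) \<partial>half_line)"
      unfolding F_def by (intro nn_integral_cong nn_integral_multc[symmetric]) measurable
    also have "\<dots> = (\<integral>\<^sup>+t. (\<integral>\<^sup>+x. k t x * u x \<partial>half_line) \<partial>half_line)"
      by (rule half_line_pair.Fubini') measurable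
    also have "\<dots> = (\<integral>\<^sup>+t. h t * (V t epow \<alpha> *
        (\<integral>\<^sup>+x. 1 / (max (V t) (V x) epow (\<alpha> + 1)) * u x \<partial>half_line)) \<partial>half_line)"
    proof (intro nn_integral_cong)
      fix t
      have "(\<integral>\<^sup>+x. k t x * u x \<partial>half_line) = (\<integral>\<^sup>+x. h t * V t epow \<alpha> *
        (1 / (max (V t) (V x) epow (\<alpha> + 1)) * u x) \<partial>half_line)"
        by (simp add: k_def mult.assoc)
      also have "\<dots> = h t * V t epow \<alpha> *
        (\<integral>\<^sup>+x. 1 / (max (V t) (V x) epow (\<alpha> + 1)) * u x \<partial>half_line)"
        by (intro nn_integral_cmult) measurable
      finally show "(\<integral>\<^sup>+x. k t x * u x \<partial>half_line) = h t * (V t epow \<alpha> *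
        (\<integral>\<^sup>+x. 1 / (max (V t) (V x) epow (\<alpha> + 1)) * u x \<partial>half_line))"
        by (simp add: mult.assoc)
    qed
    also have "\<dots> \<le> (\<integral>\<^sup>+t. h t * ennreal (2 / (1 - 2 powr - \<alpha>)) \<partial>half_line)"
      using kernel_integral_le[OF u \<open>0 < \<alpha>\<close>]
      by (intro nn_integral_mono mult_left_mono) (auto simp: V_def)
    also have "\<dots> = ennreal (2 / (1 - 2 powr - \<alpha>)) * (\<integral>\<^sup>+t. h t \<partial>half_line)"
      by (subst nn_integral_multc) (simp_all add: mult.commute)
    finally show "(\<integral>\<^sup>+x. F x * u x \<partial>half_line) \<le> \<dots>" .
  qed
qed

section \<open>The equivalence\<close>

theorem theorem2p1:
  fixes q :: ennreal and \<alpha> :: real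
    and w v V :: "real \<Rightarrow> ennreal"
    and T :: "(real \<Rightarrow> ennreal) \<Rightarrow> (real \<Rightarrow> ennreal)"
  assumes "0 < q" and "0 < \<alpha>"
    and "w \<in> weights" and "v \<in> weights"
    and "monotone_quasilinear T"
    and "V = int_upto v"
  shows "(\<exists>C::real. 0 < C \<and> (\<forall>f\<in>Mplus_down.
            wnorm q w (T f) \<le> ennreal C * wnorm 1 v f)) \<longleftrightarrow>
         (\<exists>C::real. 0 < C \<and> (\<forall>h\<in>Mplus.
            wnorm q w (T (\<lambda>x. 1 / (V x epow (\<alpha> + 1)) * int_upto (\<lambda>t. h t * V t epow \<alpha>) x))
              \<le> ennreal C * wnorm 1 (\<lambda>_. 1) h))"
    (is "?decreasing \<longleftrightarrow> ?averaging")
proof -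
  have w: "w \<in> Mplus" and v: "v \<in> Mplus" using assms by (auto simp: weights_def)
  have [measurable]: "v \<in> borel_measurable half_line" "V \<in> borel_measurable half_line"
    using v assms(6) by (auto simp: Mplus_def)
  define A where "A h x = 1 / (V x epow (\<alpha> + 1)) * int_upto (\<lambda>t. h t * V t epow \<alpha>) x" for h x
  have A_Mplus: "A h \<in> Mplus" if "h \<in> Mplus" for h
  proof -
    have [measurable]: "h \<in> borel_measurable half_line" using that by (simp add: Mplus_def)
    have "(\<lambda>t. h t * V t epow \<alpha>) \<in> Mplus" unfolding Mplus_def by measurable
    from borel_measurable_int_upto[OF this] show ?thesis
      unfolding A_def[abs_def] Mplus_def by measurable
  qed
  define K where "K = 2 / (1 - 2 powr - \<alpha>)"
  have "(2::real) powr - \<alpha> < 2 powr 0" using \<open>0 < \<alpha>\<close> by (intro powr_less_mono) auto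
  then have "0 < K" by (simp add: K_def)
  have "?decreasing \<longleftrightarrow> (\<exists>C::real. 0 < C \<and> (\<forall>h\<in>Mplus.
      wnorm q w (T (A h)) \<le> ennreal C * wnorm 1 (\<lambda>_. 1) h))"
  proof
    assume ?decreasing
    then obtain C :: real where C: "0 < C"
      "\<And>f. f \<in> Mplus_down \<Longrightarrow> wnorm q w (T f) \<le> ennreal C * wnorm 1 v f" by blast
    obtain D :: real where D: "0 < D"
      "\<And>f g. f \<in> Mplus \<Longrightarrow> g \<in> Mplus \<Longrightarrow> AE x in half_line. f x \<le> ennreal 1 * g x
        \<Longrightarrow> wnorm q w (T f) \<le> ennreal D * wnorm q w (T g)"
      using monotone_quasilinear_wnorm_le[OF assms(5,1) w, of 1] by auto
    have "wnorm q w (T (A h)) \<le> ennreal (D * (C * K)) * wnorm 1 (\<lambda>_. 1) h" if h: "h \<in> Mplus" for h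
    proof -
      obtain F where F: "F \<in> Mplus_down" "\<And>x. A h x \<le> F x"
        "(\<integral>\<^sup>+x. F x * v x \<partial>half_line) \<le> ennreal K * (\<integral>\<^sup>+t. h t \<partial>half_line)"
        using averaging_le_decreasing[OF v h \<open>0 < \<alpha>\<close>] unfolding A_def assms(6) K_def by blast
      have "wnorm q w (T (A h)) \<le> ennreal D * wnorm q w (T F)"
        using F A_Mplus[OF h] by (intro D) (auto simp: Mplus_down_def)
      also have "\<dots> \<le> ennreal D * (ennreal C * wnorm 1 v F)"
        by (intro mult_left_mono C F) simp
      also have "\<dots> \<le> ennreal D * (ennreal C * (ennreal K * wnorm 1 (\<lambda>_. 1) h))"
        using F by (intro mult_left_mono) (auto simp: wnorm_1)
      also have "\<dots> = ennreal (D * (C * K)) * wnorm 1 (\<lambda>_. 1) h"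
        using C D \<open>0 < K\<close> by (simp add: ennreal_mult mult.assoc)
      finally show ?thesis .
    qed
    then show "\<exists>C::real. 0 < C \<and> (\<forall>h\<in>Mplus. wnorm q w (T (A h)) \<le> ennreal C * wnorm 1 (\<lambda>_. 1) h)"
      using C D \<open>0 < K\<close> by (intro exI[of _ "D * (C * K)"]) auto
  next
    assume "\<exists>C::real. 0 < C \<and> (\<forall>h\<in>Mplus. wnorm q w (T (A h)) \<le> ennreal C * wnorm 1 (\<lambda>_. 1) h)"
    then obtain C :: real where C: "0 < C"
      "\<And>h. h \<in> Mplus \<Longrightarrow> wnorm q w (T (A h)) \<le> ennreal C * wnorm 1 (\<lambda>_. 1) h" by blast
    obtain D :: real where D: "0 < D"
      "\<And>f g. f \<in> Mplus \<Longrightarrow> g \<in> Mplus \<Longrightarrow> AE x in half_line. f x \<le> ennreal (2 powr (\<alpha> + 1)) * g x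
        \<Longrightarrow> wnorm q w (T f) \<le> ennreal D * wnorm q w (T g)"
      using monotone_quasilinear_wnorm_le[OF assms(5,1) w, of "2 powr (\<alpha> + 1)"] by auto
    have "wnorm q w (T f) \<le> ennreal (D * C) * wnorm 1 v f" if f: "f \<in> Mplus_down" for f
    proof (cases "wnorm 1 v f = \<infinity>")
      case True
      then show ?thesis using C D by (simp add: ennreal_mult_top)
    next
      case False
      then have fin: "(\<integral>\<^sup>+t. f t * v t \<partial>half_line) < \<infinity>" by (simp add: wnorm_1 less_top)
      have fM: "f \<in> Mplus" and fv: "(\<lambda>t. f t * v t) \<in> Mplus"
        using f by (auto simp: Mplus_down_def Mplus_def)
      have "AE x in half_line. f x \<le> ennreal (2 powr (\<alpha> + 1)) * A (\<lambda>t. f t * v t) x"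
        using decreasing_le_averaging[OF \<open>v \<in> weights\<close> \<open>0 < \<alpha>\<close> f fin]
        by (intro AE_I2) (simp add: A_def assms(6))
      then have "wnorm q w (T f) \<le> ennreal D * wnorm q w (T (A (\<lambda>t. f t * v t)))"
        by (intro D fM A_Mplus fv)
      also have "\<dots> \<le> ennreal D * (ennreal C * wnorm 1 (\<lambda>_. 1) (\<lambda>t. f t * v t))"
        by (intro mult_left_mono C fv) simp
      also have "\<dots> = ennreal (D * C) * wnorm 1 v f"
        using C D by (simp add: wnorm_1 ennreal_mult mult.assoc)
      finally show ?thesis .
    qed
    then show ?decreasing using C D by (intro exI[of _ "D * C"]) auto
  qed
  then show ?thesis unfolding A_def .
qed

end
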